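(* Let $n,p,r$ be integers with $1\le p\le n$ and $1\le r\le n-p+1$. Then $|\mathcal{T}_n^{(r,p)}|=\Delta^{r-1}\big(B_{n-p+1-r,p}\big)=\sum_{j=0}^{r-1}(-1)^{r-1-j}\binom{r-1}{j}B_{n-p+1-r+j,\,p}$, where $\Delta$ is the forward difference operator acting on the first index.
   Context: Sites are the integers $0,1,\dots,n+1$. A configuration in $\mathcal{S}(n,p)$ is a placement of $n+1$ distinct chips labeled $1,\dots,n+1$ such that sites $0,n+1$ are empty, every site in $\{1,\dots,n\}\setminus\{p\}$ holds exactly one chip and site $p$ holds exactly two chips. Toppling: while some site holds at least two chips, choose such a site $i$ and two chips $\alpha<\beta$ there and move $\alpha$ to site $i-1$, $\beta$ to site $i+1$. It is known this terminates with at most one chip per site, within sites $0,\dots,n+1$, and the final configuration is independent of the choices; reading labels left to right gives a permutation of $[n+1]$. For $\pi=\pi_1\cdots\pi_n\in S_n$ and $r\in[n+1]$, the configuration $\pi^{(r,p)}\in\mathcal{S}(n,p)$ places at site $i$ ($1\le i\le n$) the chip $\pi_i$ if $\pi_i<r$ and $\pi_i+1$ if $\pi_i\ge r$, and places in addition the chip $r$ at site $p$. $\mathcal{T}_n^{(r,p)}$ is the set of $\pi\in S_n$ such that toppling $\pi^{(r,p)}$ yields the identity permutation. Forward difference: $\Delta f(m)=f(m+1)-f(m)$, $\Delta^{k}$ its $k$-fold composition, $\Delta^0 f=f$. Poly-Bernoulli numbers of type B: $\sum_{n\ge0}B_{n,k}\frac{x^n}{n!}=\frac{\mathrm{Li}_{-k}(1-e^{-x})}{1-e^{-x}}$,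 $\mathrm{Li}_s(z)=\sum_{i\ge1}z^i/i^s$; equivalently $B_{n,k}=\sum_{m=0}^{\min(n,k)}(m!)^2\left\{{n+1\atop m+1}\right\}\left\{{k+1\atop m+1}\right\}$. *)

theory Defs
  imports Main "HOL-Combinatorics.Stirling" "HOL-Combinatorics.Permutations"
begin

text \<open>A chip configuration: to each site (an integer) the set of chip labels there.\<close>
type_synonym config = "int \<Rightarrow> nat set"

definition topple_step :: "config \<Rightarrow> config \<Rightarrow> bool" where
  "topple_step c d \<longleftrightarrow> (\<exists>i a b. 2 \<le> card (c i) \<and> a \<in> c i \<and> b \<in> c i \<and> a < b \<and>
     d = c(i := c i - {a, b}, i - 1 := insert a (c (i - 1)), i + 1 := insert b (c (i + 1))))"

definition stable :: "config \<Rightarrow> bool" where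
  "stable c \<longleftrightarrow> (\<forall>i. card (c i) \<le> 1)"

definition reads_identity :: "config \<Rightarrow> bool" where
  "reads_identity c \<longleftrightarrow> (\<forall>i j a b. i < j \<longrightarrow> a \<in> c i \<longrightarrow> b \<in> c j \<longrightarrow> a < b)"

text \<open>Toppling c yields the identity permutation (final configuration is choice-independent).\<close>
definition topples_to_identity :: "config \<Rightarrow> bool" where
  "topples_to_identity c \<longleftrightarrow> (\<exists>d. topple_step\<^sup>*\<^sup>* c d \<and> stable d \<and> reads_identity d)"

definition init_config :: "nat \<Rightarrow> (nat \<Rightarrow> nat) \<Rightarrow> nat \<Rightarrow> nat \<Rightarrow> config" where
  "init_config n \<pi> r p = (\<lambda>i.
     (if 1 \<le> i \<and> i \<le> int n then {if \<pi> (nat i) < r then \<pi> (nat i) else \<pi> (nat i) + 1} else {})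
     \<union> (if i = int p then {r} else {}))"

definition T_set :: "nat \<Rightarrow> nat \<Rightarrow> nat \<Rightarrow> (nat \<Rightarrow> nat) set" where
  "T_set n r p = {\<pi>. \<pi> permutes {1..n} \<and> topples_to_identity (init_config n \<pi> r p)}"

text \<open>Poly-Bernoulli numbers of type B (Stirling-number formula).\<close>
definition polyB :: "nat \<Rightarrow> nat \<Rightarrow> int" where
  "polyB n k = (\<Sum>m = 0..min n k. int ((fact m)^2 * Stirling (n+1) (m+1) * Stirling (k+1) (m+1)))"

definition fwd_diff :: "(nat \<Rightarrow> int) \<Rightarrow> nat \<Rightarrow> int" where
  "fwd_diff f m = f (m + 1) - f m"

end

theory Submission
  imports Defs "HOL-Library.FuncSet"
begin

text \<open>
  Let \<open>k i\<close> be the number of times site \<open>i\<close> has toppled. It increases towards \<open>p\<close> with slopes in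
  \<open>{0, 1}\<close> and determines the number of chips on each site; in particular no site ever holds more than
  two chips. Require of every chip \<open>x\<close> at site \<open>i\<close> that
  \<open>1 + max 0 (i - p) + k i \<le> x \<le> n + 1 - max 0 (p - i) - k i\<close>. When a site with chips \<open>a < b\<close> topples,
  the common window \<open>[l, u]\<close> of its two chips splits into \<open>[l, u - 1]\<close> for \<open>a\<close> and \<open>[l + 1, u]\<close> for \<open>b\<close>,
  so the requirement holds before a toppling iff it holds afterwards. In a stable configuration it
  says that the labels are sorted. Taking \<open>k = 0\<close> describes the permutations to be counted by restrictions
  on their positions.

  With \<open>m = n - p\<close>, the \<open>p\<close> left positions are restricted only with respect to the \<open>p\<close> large values, and
  the \<open>m\<close> right positions only with respect to the \<open>m\<close> small values, in both cases by a staircase. Leaving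
  \<open>a\<close> positions unmatched in each staircase gives the factor \<open>(a!)\<^sup>2\<close>. The left staircase contributes the
  Stirling number \<open>S(p + 1, a + 1)\<close>. In the right one, \<open>m - r + 1\<close> rows act on the coefficients by
  the Stirling recursion \<open>A\<close>, and the \<open>r - 1\<close> rows without their diagonal cell act by \<open>A - 1\<close>, which
  is the forward difference.
\<close>

section \<open>Forward differences and staircase coefficients\<close>

lemma fwd_diff_funpow_Suc:
  "(fwd_diff ^^ Suc s) f m = (fwd_diff ^^ s) f (Suc m) - (fwd_diff ^^ s) f m"
  by (simp add: fwd_diff_def)

lemma fwd_diff_funpow_sum:
  "(fwd_diff ^^ s) (\<lambda>m. \<Sum>a\<in>A. c a * f a m) m = (\<Sum>a\<in>A. c a * (fwd_diff ^^ s) (f a) m)"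
proof (induction s arbitrary: m)
  case (Suc s)
  then show ?case
    by (simp only: fwd_diff_funpow_Suc sum_subtractf[symmetric] right_diff_distrib)
qed simp

lemma fwd_diff_funpow_eq_sum:
  "(fwd_diff ^^ s) f m = (\<Sum>j = 0..s. (-1) ^ (s - j) * int (s choose j) * f (m + j))"
proof (induction s arbitrary: m)
  case (Suc s)
  let ?t = "\<lambda>j. (-1) ^ (s - j) * int (s choose j) * f (Suc m + j)"
  let ?u = "\<lambda>j. (-1) ^ (s - j) * int (s choose j) * f (m + j)"
  let ?v = "\<lambda>j. (-1) ^ (Suc s - j) * int (Suc s choose j) * f (m + j)"
  have "(\<Sum>j = 0..Suc s. ?v j) = ?v 0 + (\<Sum>j = 0..s. ?v (Suc j))"
    by (rule sum.atLeast0_atMost_Suc_shift[unfolded comp_def])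
  also have "(\<Sum>j = 0..s. ?v (Suc j)) = (\<Sum>j = 0..s. ?t j + (-1) ^ (s - j) * int (s choose Suc j) * f (m + Suc j))"
    by (intro sum.cong) (auto simp: algebra_simps)
  also have "\<dots> = (\<Sum>j = 0..s. ?t j) + (\<Sum>j = 0..s. (-1) ^ (s - j) * int (s choose Suc j) * f (m + Suc j))"
    by (simp add: sum.distrib)
  also have "(\<Sum>j = 0..s. (-1) ^ (s - j) * int (s choose Suc j) * f (m + Suc j))
      = (\<Sum>j = 0..s. - ?u (Suc j))"
  proof (intro sum.cong refl)
    fix j assume "j \<in> {0..s}"
    \<comment> \<open>For \<open>j = s\<close> the binomial coefficient vanishes; otherwise the
      truncated exponent drops by one and the sign flips.\<close>
    then consider "j = s" | "s - j = Suc (s - Suc j)" by fastforce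
    then show "(-1) ^ (s - j) * int (s choose Suc j) * f (m + Suc j) = - ?u (Suc j)"
      by cases (simp_all del: One_nat_def)
  qed
  also have "?v 0 + ((\<Sum>j = 0..s. ?t j) + (\<Sum>j = 0..s. - ?u (Suc j)))
     = (\<Sum>j = 0..s. ?t j) - (?u 0 + (\<Sum>j = 0..s. ?u (Suc j)))"
    by (simp add: sum_negf)
  also have "?u 0 + (\<Sum>j = 0..s. ?u (Suc j)) = (\<Sum>j = 0..Suc s. ?u j)"
    by (rule sum.atLeast0_atMost_Suc_shift[symmetric, unfolded comp_def])
  also have "\<dots> = (\<Sum>j = 0..s. ?u j)" by simp
  finally show ?case
    unfolding fwd_diff_funpow_Suc Suc by simp
qed simp

text \<open>\<open>coeff_fwd w N a\<close> counts placements of \<open>N - a\<close> non-attacking rooks on a staircase whose row \<open>i\<close>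
  consists of the columns below \<open>i + w i\<close>; \<open>coeff_bwd\<close> is the adjoint recursion, where \<open>t\<close> is the
  number of rows still to be processed.\<close>

fun coeff_fwd :: "(nat \<Rightarrow> nat) \<Rightarrow> nat \<Rightarrow> nat \<Rightarrow> nat" where
  "coeff_fwd w 0 a = (if a = 0 then 1 else 0)"
| "coeff_fwd w (Suc i) a = (w i + a) * coeff_fwd w i a + (if a = 0 then 0 else coeff_fwd w i (a - 1))"

fun coeff_bwd :: "(nat \<Rightarrow> nat) \<Rightarrow> nat \<Rightarrow> (nat \<Rightarrow> nat) \<Rightarrow> nat \<Rightarrow> nat \<Rightarrow> nat" where
  "coeff_bwd w N e 0 a = e a"
| "coeff_bwd w N e (Suc t) a =
     (w (N - Suc t) + a) * coeff_bwd w N e t a + coeff_bwd w N e t (Suc a)"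

lemma coeff_fwd_eq_0: "i < a \<Longrightarrow> coeff_fwd w i a = 0"
  by (induction i arbitrary: a) auto

text \<open>Pairing \<open>coeff_fwd\<close> after \<open>i\<close> rows with
  \<open>coeff_bwd\<close> for the other \<open>N - i\<close> rows gives a value independent of
  \<open>i\<close>; the two sides are its cases \<open>i = 0\<close> and
  \<open>i = N\<close>.\<close>

lemma coeff_bwd_eq_sum:
  "coeff_bwd w N e N 0 = (\<Sum>a\<le>N. coeff_fwd w N a * e a)"
proof -
  have "i \<le> N \<Longrightarrow> coeff_bwd w N e N 0 = (\<Sum>a\<le>i. coeff_fwd w i a * coeff_bwd w N e (N - i) a)" for i
  proof (induction i)
    case (Suc i)
    let ?G = "coeff_bwd w N e (N - Suc i)"
    have N: "N - i = Suc (N - Suc i)" "N - Suc (N - Suc i) = i"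
      using Suc.prems by auto
    have "coeff_bwd w N e N 0 = (\<Sum>a\<le>i. coeff_fwd w i a * ((w i + a) * ?G a + ?G (Suc a)))"
      using Suc N by simp
    also have "\<dots> = (\<Sum>a\<le>i. (w i + a) * coeff_fwd w i a * ?G a) + (\<Sum>a\<le>i. coeff_fwd w i a * ?G (Suc a))"
      by (simp add: sum.distrib[symmetric] algebra_simps)
    also have "(\<Sum>a\<le>i. (w i + a) * coeff_fwd w i a * ?G a) = (\<Sum>a\<le>Suc i. (w i + a) * coeff_fwd w i a * ?G a)"
      by (simp add: coeff_fwd_eq_0)
    also have "(\<Sum>a\<le>i. coeff_fwd w i a * ?G (Suc a)) =
        (\<Sum>a\<le>Suc i. (if a = 0 then 0 else coeff_fwd w i (a - 1)) * ?G a)"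
      by (subst sum.atMost_Suc_shift) simp
    finally show ?case
      by (simp only: sum.distrib[symmetric] coeff_fwd.simps distrib_right)
  qed simp
  from this[of N] show ?thesis by simp
qed

lemma coeff_fwd_one: "coeff_fwd (\<lambda>_. 1) N a = Stirling (Suc N) (Suc a)"
proof (induction N arbitrary: a)
  case 0 then show ?case by (cases a) auto
next
  case (Suc N) then show ?case by (cases a) auto
qed

text \<open>A row of weight 1 has factor \<open>1 + a\<close> and a row of weight 0 has factor
  \<open>a\<close>, with the same shift term. The latter thus acts as the former minus the
  identity.\<close>

lemma coeff_fwd_eq_fwd_diff:
  "int (coeff_fwd (\<lambda>i. if i < M then 1 else 0) (M + s) a) =
     (fwd_diff ^^ s) (\<lambda>m. int (Stirling (Suc m) (Suc a))) M"
proof -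
  define f where "f s a = (fwd_diff ^^ s) (\<lambda>m. int (Stirling (Suc m) (Suc a)))" for s a
  \<comment> \<open>The coefficients of the Stirling recursion do not depend on \<open>M\<close>, so
    it survives differencing in \<open>M\<close>.\<close>
  have f_Suc: "f s a (Suc M) = (int a + 1) * f s a M + (if a = 0 then 0 else f s (a - 1) M)" for s a M
  proof (induction s arbitrary: M)
    case 0 then show ?case by (cases a) (auto simp: f_def algebra_simps)
  next
    case (Suc s)
    have "f (Suc s) a (Suc M) = f s a (Suc (Suc M)) - f s a (Suc M)"
      by (simp only: f_def fwd_diff_funpow_Suc)
    also have "\<dots> = (int a + 1) * (f s a (Suc M) - f s a M) +
        (if a = 0 then 0 else f s (a - 1) (Suc M) - f s (a - 1) M)"
      using Suc.IH[of "Suc M"] Suc.IH[of M] by (simp add: algebra_simps)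
    finally show ?case by (simp only: f_def fwd_diff_funpow_Suc)
  qed
  have "int (coeff_fwd (\<lambda>i. if i < M then 1 else 0) (M + s) a) = f s a M"
  proof (induction s arbitrary: a)
    case 0
    have "coeff_fwd (\<lambda>i. if i < M then 1 else 0) i a = coeff_fwd (\<lambda>_. 1) i a" if "i \<le> M" for i a
      using that by (induction i arbitrary: a) auto
    then show ?case by (simp add: coeff_fwd_one f_def del: Stirling.simps One_nat_def)
  next
    case (Suc s)
    have "f (Suc s) a M = f s a (Suc M) - f s a M"
      by (simp only: f_def fwd_diff_funpow_Suc)
    then show ?case
      using Suc.IH by (simp add: f_Suc algebra_simps)
  qed
  then show ?thesis by (simp add: f_def)
qed

section \<open>Toppling\<close>

text \<open>The cardinality clause adds the discrete Laplacian of \<open>k\<close> to the initial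
  load: a toppling removes two chips and hands one to each neighbour.\<close>

definition odometer_inv :: "int \<Rightarrow> int \<Rightarrow> config \<Rightarrow> (int \<Rightarrow> int) \<Rightarrow> bool" where
  "odometer_inv n p c k \<longleftrightarrow>
     (\<forall>i. int (card (c i)) = (if 1 \<le> i \<and> i \<le> n then 1 else 0) + (if i = p then 1 else 0)
        + k (i - 1) + k (i + 1) - 2 * k i) \<and>
     (\<forall>i. i \<le> 0 \<or> n + 1 \<le> i \<longrightarrow> k i = 0) \<and>
     (\<forall>i<p. k i \<le> k (i + 1) \<and> k (i + 1) \<le> k i + 1) \<and>
     (\<forall>i\<ge>p. k (i + 1) \<le> k i \<and> k i \<le> k (i + 1) + 1) \<and>
     (\<forall>i j x. x \<in> c i \<longrightarrow> x \<in> c j \<longrightarrow> i = j) \<and>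
     (\<forall>i. c i \<subseteq> {1..nat (n + 1)})"

definition chip_bounds :: "int \<Rightarrow> int \<Rightarrow> config \<Rightarrow> (int \<Rightarrow> int) \<Rightarrow> bool" where
  "chip_bounds n p c k \<longleftrightarrow>
     (\<forall>i. \<forall>x\<in>c i. 1 + max 0 (i - p) + k i \<le> int x \<and> int x \<le> n + 1 - max 0 (p - i) - k i)"

lemma topple_step_inv:
  assumes inv: "odometer_inv n p c k" and pn: "1 \<le> p" "p \<le> n" and st: "topple_step c d"
  obtains i where "1 \<le> i" "i \<le> n" "odometer_inv n p d (k(i := k i + 1))"
    "chip_bounds n p c k \<longleftrightarrow> chip_bounds n p d (k(i := k i + 1))"
proof -
  from st obtain i a b where c2: "2 \<le> card (c i)" and ab: "a \<in> c i" "b \<in> c i" "a < b"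
    and d: "d = c(i := c i - {a, b}, i - 1 := insert a (c (i - 1)), i + 1 := insert b (c (i + 1)))"
    unfolding topple_step_def by blast
  let ?k = "k(i := k i + 1)"
  have cd: "\<And>i. int (card (c i)) = (if 1 \<le> i \<and> i \<le> n then 1 else 0) + (if i = p then 1 else 0)
        + k (i - 1) + k (i + 1) - 2 * k i"
    and k0: "\<And>i. i \<le> 0 \<or> n + 1 \<le> i \<Longrightarrow> k i = 0"
    and sl: "\<And>i. i < p \<Longrightarrow> k i \<le> k (i + 1) \<and> k (i + 1) \<le> k i + 1"
    and sr: "\<And>i. i \<ge> p \<Longrightarrow> k (i + 1) \<le> k i \<and> k i \<le> k (i + 1) + 1"
    and dj: "\<And>i j x. x \<in> c i \<Longrightarrow> x \<in> c j \<Longrightarrow> i = j"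
    and sub: "\<And>i. c i \<subseteq> {1..nat (n + 1)}"
    using inv unfolding odometer_inv_def by blast+
  have fin: "finite (c i)" for i using sub[of i] finite_subset by blast
  note s = sl[of i] sr[of i] sl[of "i - 1"] sr[of "i - 1"]
  have i1n: "1 \<le> i \<and> i \<le> n"
  proof (rule ccontr)
    assume "\<not> ?thesis"
    then have "i \<le> 0 \<or> n + 1 \<le> i" by linarith
    then show False
      using c2 cd[of i] k0[of i] k0[of "i-1"] k0[of "i+1"] s pn by (auto split: if_splits)
  qed
  \<comment> \<open>The cardinality is the load plus a difference of adjacent slopes, so two chips
    fix both slopes: off \<open>p\<close>, flat on the outer side and steep towards
    \<open>p\<close>; at \<open>p\<close>, flat on both sides.\<close>
  have kl: "k (i - 1) = (if i \<le> p then k i else k i + 1)"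
    and kr: "k (i + 1) = (if p \<le> i then k i else k i + 1)"
    and card2: "card (c i) = 2"
    using c2 cd[of i] s i1n by (cases i p rule: linorder_cases; force)+
  have ci: "c i = {a, b}"
    using card2 ab fin[of i] by (metis card_2_iff card_seteq empty_subsetI insert_subset less_irrefl order_refl card_2_iff')
  have nota: "a \<notin> c (i - 1)" and notb: "b \<notin> c (i + 1)"
    using dj[of a i "i-1"] dj[of b i "i+1"] ab by auto
  have di: "d i = {}" "d (i - 1) = insert a (c (i - 1))" "d (i + 1) = insert b (c (i + 1))"
    and dj': "\<And>j. j \<noteq> i \<Longrightarrow> j \<noteq> i - 1 \<Longrightarrow> j \<noteq> i + 1 \<Longrightarrow> d j = c j"
    using d ci by auto
  have inv': "odometer_inv n p d ?k"
    unfolding odometer_inv_def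
  proof (intro conjI allI impI)
    fix j
    consider "j = i" | "j = i - 1" | "j = i + 1" | "j \<noteq> i \<and> j \<noteq> i - 1 \<and> j \<noteq> i + 1" by blast
    then show "int (card (d j)) = (if 1 \<le> j \<and> j \<le> n then 1 else 0) + (if j = p then 1 else 0)
        + ?k (j - 1) + ?k (j + 1) - 2 * ?k j"
      using cd[of j]
      by cases (simp_all add: di dj' card2 fin nota notb)
  next
    fix j assume "j \<le> 0 \<or> n + 1 \<le> j"
    then show "?k j = 0" using k0 i1n by auto
  next
    fix j assume "j < p"
    then show "?k j \<le> ?k (j + 1)" "?k (j + 1) \<le> ?k j + 1"
      using sl[of j] kl kr by (auto split: if_splits)
  next
    fix j assume "p \<le> j"
    then show "?k (j + 1) \<le> ?k j" "?k j \<le> ?k (j + 1) + 1"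
      using sr[of j] kl kr by (auto split: if_splits)
  next
    fix j l x assume "x \<in> d j" "x \<in> d l"
    then have "(x = a \<and> j = i - 1) \<or> (x = b \<and> j = i + 1) \<or> (x \<in> c j \<and> j \<noteq> i)"
      "(x = a \<and> l = i - 1) \<or> (x = b \<and> l = i + 1) \<or> (x \<in> c l \<and> l \<noteq> i)"
      unfolding d using ci by (auto split: if_splits)
    then show "j = l" using dj ab by blast
  next
    fix j show "d j \<subseteq> {1..nat (n + 1)}"
      unfolding d using sub[of j] sub[of i] ab by (auto split: if_splits)
  qed
  have "chip_bounds n p c k \<longleftrightarrow> chip_bounds n p d ?k"
  proof -
    let ?B = "\<lambda>k j x. 1 + max 0 (j - p) + k j \<le> int x \<and> int x \<le> n + 1 - max 0 (p - j) - k j"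
    have split: "(\<forall>j. P j) \<longleftrightarrow> P i \<and> P (i - 1) \<and> P (i + 1) \<and> (\<forall>j. j \<noteq> i \<and> j \<noteq> i - 1 \<and> j \<noteq> i + 1 \<longrightarrow> P j)"
      for P :: "int \<Rightarrow> bool" by metis
    have rest: "(\<forall>j. j \<noteq> i \<and> j \<noteq> i - 1 \<and> j \<noteq> i + 1 \<longrightarrow> (\<forall>x\<in>c j. ?B k j x)) \<longleftrightarrow>
       (\<forall>j. j \<noteq> i \<and> j \<noteq> i - 1 \<and> j \<noteq> i + 1 \<longrightarrow> (\<forall>x\<in>d j. ?B ?k j x))"
      using dj' by auto
    \<comment> \<open>By \<open>kl\<close> and \<open>kr\<close> the neighbours have the windows
      \<open>[l, u - 1]\<close> and \<open>[l + 1, u]\<close>; \<open>a < b\<close> excludes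
      \<open>a = u\<close> and \<open>b = l\<close>.\<close>
    have ab': "?B k i a \<and> ?B k i b \<longleftrightarrow> ?B ?k (i - 1) a \<and> ?B ?k (i + 1) b"
      using kl kr ab(3) by (auto simp: max_def split: if_splits)
    show ?thesis
      unfolding chip_bounds_def
      apply (subst (1 2) split)
      unfolding rest using ab' by (auto simp: di ci)
  qed
  with inv' i1n show ?thesis using that by blast
qed

lemma topple_steps_inv:
  assumes "topple_step\<^sup>*\<^sup>* c d" "odometer_inv n p c k" "1 \<le> p" "p \<le> n"
  obtains k' where "odometer_inv n p d k'" "chip_bounds n p c k \<longleftrightarrow> chip_bounds n p d k'"
proof -
  from assms(1) have "\<exists>k'. odometer_inv n p d k' \<and> (chip_bounds n p c k \<longleftrightarrow> chip_bounds n p d k')"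
  proof (induction rule: rtranclp_induct)
    case base then show ?case using assms by blast
  next
    case (step d e)
    then obtain k' where k': "odometer_inv n p d k'" "chip_bounds n p c k \<longleftrightarrow> chip_bounds n p d k'"
      by blast
    with topple_step_inv[OF k'(1) assms(3,4) step(2)] show ?case by metis
  qed
  then show ?thesis using that by blast
qed

lemma odometer_le:
  assumes "odometer_inv n p c k" "1 \<le> p" "0 \<le> i" "i \<le> n + 1"
  shows "k i \<le> i"
proof -
  have "k (int j) \<le> int j" for j
  proof (induction j)
    case 0
    then show ?case using assms(1) by (simp add: odometer_inv_def)
  next
    case (Suc j)
    then show ?case using assms(1) unfolding odometer_inv_def
      by (smt (verit) of_nat_Suc)
  qed
  from this[of "nat i"] show ?thesis using assms by simp
qed

lemma not_stable_topple_step: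
  assumes "\<not> stable c"
  obtains d where "topple_step c d"
proof -
  have "\<exists>i. 2 \<le> card (c i)" using assms by (auto simp: stable_def not_le Suc_le_eq numeral_2_eq_2)
  then obtain i where i: "2 \<le> card (c i)" ..
  then obtain x y where "x \<in> c i" "y \<in> c i" "x \<noteq> y"
    by (metis (no_types) card_2_iff insert_subset obtain_subset_with_card_n)
  then obtain a b where "a \<in> c i" "b \<in> c i" "a < b"
    by (meson linorder_neqE_nat)
  with i that show ?thesis unfolding topple_step_def by blast
qed

lemma topple_terminates:
  assumes "odometer_inv n p c k" "1 \<le> p" "p \<le> n"
  obtains d where "topple_step\<^sup>*\<^sup>* c d" "stable d"
proof -
  have "\<exists>d. topple_step\<^sup>*\<^sup>* c d \<and> stable d" if "odometer_inv n p c k" for c k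
    using that
  \<comment> \<open>Each toppling raises one \<open>k i\<close> with \<open>i\<close> in
    \<open>1..n\<close>, lowering this sum, which \<open>odometer_le\<close> keeps
    nonnegative.\<close>
  proof (induction "nat (\<Sum>i\<in>{1..n}. i - k i)" arbitrary: c k rule: less_induct)
    case less
    show ?case
    proof (cases "stable c")
      case False
      then obtain c' where c': "topple_step c c'" by (rule not_stable_topple_step)
      obtain i where i: "1 \<le> i" "i \<le> n" and inv: "odometer_inv n p c' (k(i := k i + 1))"
        using topple_step_inv[OF less.prems assms(2,3) c'] by metis
      have "(\<Sum>j\<in>{1..n}. j - (k(i := k i + 1)) j) < (\<Sum>j\<in>{1..n}. j - k j)"
        by (rule sum_strict_mono_ex1) (use i in auto)
      moreover have "0 \<le> (\<Sum>j\<in>{1..n}. j - (k(i := k i + 1)) j)"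
        using odometer_le[OF inv assms(2)] by (intro sum_nonneg) auto
      ultimately have "\<exists>d. topple_step\<^sup>*\<^sup>* c' d \<and> stable d"
        by (intro less.hyps[OF _ inv]) linarith
      with c' show ?thesis by (meson converse_rtranclp_into_rtranclp)
    qed blast
  qed
  with assms that show ?thesis by blast
qed


section \<open>The final odometer and the final configuration\<close>

text \<open>Off \<open>p\<close> the odometer is concave, so the unit slope just left of
  \<open>p\<close> extends down to site 0, and right of \<open>p\<close> a descent once begun lasts
  until \<open>n + 1\<close>. The fourfold minimum is chosen to be symmetric under the reflection
  exchanging \<open>p\<close> and \<open>n + 1 - p\<close>.\<close>

lemma stable_odometer_rising:
  fixes k :: "int \<Rightarrow> int"
  assumes pn: "1 \<le> p" "p \<le> n" and k0: "k 0 = 0" "k (n + 1) = 0"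
    and sl: "\<And>i. i < p \<Longrightarrow> k (i + 1) \<le> k i + 1"
    and sr: "\<And>i. p \<le> i \<Longrightarrow> k (i + 1) \<le> k i \<and> k i \<le> k (i + 1) + 1"
    and conc: "\<And>i. 1 \<le> i \<Longrightarrow> i \<le> n \<Longrightarrow> i \<noteq> p \<Longrightarrow> k (i - 1) + k (i + 1) \<le> 2 * k i"
    and peak: "k p = k (p - 1) + 1" and i: "0 \<le> i" "i \<le> n + 1"
  shows "k i = min (min i p) (min (n + 1 - p) (n + 1 - i))"
proof -
  have rise: "k j = k (j - 1) + 1" if "1 \<le> j" "j \<le> p" for j
    using that(2,1)
  proof (induction j rule: int_le_induct)
    case (step j)
    then show ?case using conc[of "j - 1"] sl[of "j - 2"] pn by auto
  qed (use peak in simp)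
  have left: "k j = j" if "0 \<le> j" "j \<le> p" for j
    using that
  proof (induction j rule: int_ge_induct)
    case (step j)
    then show ?case using rise[of "j + 1"] by simp
  qed (use k0 in simp)
  have fall: "k l = k j - (l - j)" if "p \<le> j" "k (j + 1) = k j - 1" "j + 1 \<le> l" "l \<le> n + 1" for j l
  proof -
    \<comment> \<open>The last slope is part of the induction claim, since concavity needs it to
      continue the descent.\<close>
    from that(3) have "l \<le> n + 1 \<longrightarrow> k l = k j - (l - j) \<and> k l = k (l - 1) - 1"
    proof (induction l rule: int_ge_induct)
      case (step l)
      then show ?case using conc[of l] sr[of l] that(1) pn by auto
    qed (use that in simp)
    with that show ?thesis by simp
  qed
  have bound: "k j \<le> n + 1 - j" if "p \<le> j" "j \<le> n + 1" for j
    using that(2,1)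
  proof (induction j rule: int_le_induct)
    case (step j)
    then show ?case using sr[of "j - 1"] by auto
  qed (use k0 in simp)
  have right: "k j = min p (n + 1 - j)" if "p \<le> j" "j \<le> n + 1" for j
    using that
  proof (induction j rule: int_ge_induct)
    case base
    \<comment> \<open>Here \<open>left\<close> and \<open>bound\<close> at \<open>p\<close> force
      \<open>p \<le> n + 1 - p\<close>.\<close>
    then show ?case using left[of p] bound[of p] pn by simp
  next
    case (step j)
    show ?case
    proof (cases "k (j + 1) = k j - 1")
      case True
      with fall[OF step.hyps True, of "n + 1"] step k0 show ?thesis by auto
    next
      case False
      then have "k (j + 1) = k j" using sr[of j] step.hyps by auto
      then show ?thesis using step bound[of "j + 1"] by auto
    qed
  qed
  show ?thesis
    using left[of i] right[of i] right[of p] left[of p] i pn by (cases "i \<le> p") auto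
qed

lemma stable_odometer:
  assumes inv: "odometer_inv n p d k" and pn: "1 \<le> p" "p \<le> n" and st: "stable d"
    and i: "0 \<le> i" "i \<le> n + 1"
  shows "k i = min (min i p) (min (n + 1 - p) (n + 1 - i))"
proof -
  have cd: "\<And>i. int (card (d i)) = (if 1 \<le> i \<and> i \<le> n then 1 else 0) + (if i = p then 1 else 0)
        + k (i - 1) + k (i + 1) - 2 * k i"
    and k0: "\<And>i. i \<le> 0 \<or> n + 1 \<le> i \<Longrightarrow> k i = 0"
    and sl: "\<And>i. i < p \<Longrightarrow> k i \<le> k (i + 1) \<and> k (i + 1) \<le> k i + 1"
    and sr: "\<And>i. i \<ge> p \<Longrightarrow> k (i + 1) \<le> k i \<and> k i \<le> k (i + 1) + 1"
    using inv unfolding odometer_inv_def by blast+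
  have c1: "int (card (d i)) \<le> 1" for i using st unfolding stable_def by (simp add: nat_le_iff)
  have conc: "k (i - 1) + k (i + 1) \<le> 2 * k i" if "1 \<le> i" "i \<le> n" "i \<noteq> p" for i
    using cd[of i] c1[of i] that by simp
  \<comment> \<open>The load at \<open>p\<close> is two, so ending with at most one chip there
    requires a strict descent on some side.\<close>
  have "k p = k (p - 1) + 1 \<or> k p = k (p + 1) + 1"
    using cd[of p] c1[of p] pn sl[of "p - 1"] sr[of p] by auto
  then show ?thesis
  proof
    assume "k p = k (p - 1) + 1"
    with stable_odometer_rising[of p n k i] pn k0 sl sr conc i show ?thesis by auto
  next
    assume pk: "k p = k (p + 1) + 1"
    \<comment> \<open>Mirror image of the first case: the reflected odometer has its peak at
      \<open>n + 1 - p\<close>, with the unit slope on the left.\<close>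
    have "k (n + 1 - (n + 1 - i)) = min (min (n + 1 - i) (n + 1 - p))
       (min (n + 1 - (n + 1 - p)) (n + 1 - (n + 1 - i)))"
    proof (rule stable_odometer_rising[where k = "\<lambda>j. k (n + 1 - j)"])
      fix j assume "j < n + 1 - p"
      then show "k (n + 1 - (j + 1)) \<le> k (n + 1 - j) + 1"
        using sr[of "n - j"] by (simp add: algebra_simps)
    next
      fix j assume "n + 1 - p \<le> j"
      then show "k (n + 1 - (j + 1)) \<le> k (n + 1 - j) \<and> k (n + 1 - j) \<le> k (n + 1 - (j + 1)) + 1"
        using sl[of "n - j"] by (simp add: algebra_simps)
    next
      fix j assume "1 \<le> j" "j \<le> n" "j \<noteq> n + 1 - p"
      then show "k (n + 1 - (j - 1)) + k (n + 1 - (j + 1)) \<le> 2 * k (n + 1 - j)"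
        using conc[of "n + 1 - j"] by (simp add: algebra_simps)
    qed (use pn k0 i pk in \<open>auto simp: algebra_simps\<close>)
    then show ?thesis by (simp add: min.commute min.left_commute)
  qed
qed

text \<open>Both maps are onto \<open>A\<close> by cardinality, so their sums agree and no
  inequality can be strict.\<close>

lemma inj_on_interval_pointwise_le:
  fixes f g :: "int \<Rightarrow> int"
  assumes inj: "inj_on f {a..b}" "inj_on g {a..b}"
    and maps: "f ` {a..b} \<subseteq> A" "g ` {a..b} \<subseteq> A" and A: "finite A" "card A = card {a..b}"
    and le: "\<And>i. i \<in> {a..b} \<Longrightarrow> f i \<le> g i" and i: "i \<in> {a..b}"
  shows "f i = g i"
proof -
  have "f ` {a..b} = A" "g ` {a..b} = A"
    using inj maps A by (metis card_image card_subset_eq)+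
  then have "sum f {a..b} = sum g {a..b}"
    using sum.reindex[OF inj(1), of id] sum.reindex[OF inj(2), of id] by simp
  then show ?thesis using sum_mono_inv[of f "{a..b}" g i] le i by simp
qed

lemma strict_mono_int_gap:
  fixes g :: "int \<Rightarrow> int"
  assumes "\<And>i. a \<le> i \<Longrightarrow> i < b \<Longrightarrow> g i < g (i + 1)" "a \<le> i" "i \<le> j" "j \<le> b"
  shows "g i + (j - i) \<le> g j"
  using assms(3,4)
proof (induction j rule: int_ge_induct)
  case (step j)
  then show ?case using assms(1)[of j] assms(2) by simp
qed simp

text \<open>The explicit odometer locates the chips and turns the windows into
  \<open>[i + 1, e]\<close> left of the hole \<open>e\<close> and \<open>[e + 1, i]\<close> right of
  it; only the sorted labelling fits.\<close>

lemma stable_chip_bounds_iff: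
  assumes inv: "odometer_inv n p d k" and pn: "1 \<le> p" "p \<le> n" and st: "stable d"
  shows "chip_bounds n p d k \<longleftrightarrow> reads_identity d"
proof -
  \<comment> \<open>The one site of \<open>0..n + 1\<close> that ends up empty.\<close>
  define e where "e = n + 1 - p"
  have e: "1 \<le> e" "e \<le> n" using pn by (auto simp: e_def)
  have cd: "\<And>i. int (card (d i)) = (if 1 \<le> i \<and> i \<le> n then 1 else 0) + (if i = p then 1 else 0)
        + k (i - 1) + k (i + 1) - 2 * k i"
    and k0: "\<And>i. i \<le> 0 \<or> n + 1 \<le> i \<Longrightarrow> k i = 0"
    and dj: "\<And>i j x. x \<in> d i \<Longrightarrow> x \<in> d j \<Longrightarrow> i = j"
    and sub: "\<And>i. d i \<subseteq> {1..nat (n + 1)}"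
    using inv unfolding odometer_inv_def by blast+
  have fin: "finite (d i)" for i using sub[of i] finite_subset by blast
  have kk: "k i = (if i \<le> min p e then i else if i \<le> max p e then min p e else n + 1 - i)"
    if "0 \<le> i" "i \<le> n + 1" for i
    using stable_odometer[OF inv pn st that] pn that by (simp add: e_def min_def max_def)
  have pe: "min p e + max p e = n + 1" "i = p \<or> i = e \<longleftrightarrow> i = min p e \<or> i = max p e"
    "p = e \<longleftrightarrow> min p e = max p e" "min p e \<le> max p e" "1 \<le> min p e" for i
    using pn by (auto simp: e_def min_def max_def)
  have k1: "k 1 = 1" "k n = 1"
    using kk[of 1] kk[of n] pe e by (smt (verit))+
  define S where "S = {0..e - 1} \<union> {e + 1..n + 1}"
  have card: "int (card (d i)) = (if i \<in> S then 1 else 0)" for i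
  proof -
    consider "i \<le> -1" | "i = 0" | "1 \<le> i \<and> i \<le> n" | "i = n + 1" | "n + 2 \<le> i" by linarith
    then show ?thesis
    proof cases
      case 3
      \<comment> \<open>The trapezoid \<open>k\<close> bends only at \<open>p\<close> and
        \<open>e\<close>, doubly if they coincide. The bend at \<open>p\<close> cancels the extra
        chip, the one at \<open>e\<close> leaves the hole.\<close>
      then have "k (i - 1) + k (i + 1) - 2 * k i = (if i = min p e then -1 else 0) + (if i = max p e then -1 else 0)"
        using kk[of i] kk[of "i - 1"] kk[of "i + 1"] pe by (smt (verit))
      also have "\<dots> = (if i = p then -1 else 0) + (if i = e then -1 else 0)"
        by (auto simp: min_def max_def)
      finally show ?thesis
        using cd[of i] 3 by (auto simp: S_def)
    qed (use cd[of i] k0[of i] k0[of "i - 1"] k0[of "i + 1"] k1 pn e in \<open>simp_all add: S_def\<close>)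
  qed
  define g where "g i = int (the_elem (d i))" for i
  have dS: "d i = {nat (g i)}" if "i \<in> S" for i
  proof -
    have "card (d i) = 1" using card[of i] that by simp
    then obtain x where "d i = {x}" by (rule card_1_singletonE)
    then show ?thesis by (simp add: g_def)
  qed
  have dN: "d i = {}" if "i \<notin> S" for i
    using card[of i] that fin[of i] by simp
  have g1: "1 \<le> g i" "g i \<le> n + 1" if "i \<in> S" for i
    using sub[of i] dS[OF that] pn by auto
  have ginj: "inj_on g S"
    using dj dS by (intro inj_onI) (metis singletonI)
  have bounds: "chip_bounds n p d k \<longleftrightarrow>
      (\<forall>i\<in>{0..e - 1}. i + 1 \<le> g i \<and> g i \<le> e) \<and> (\<forall>i\<in>{e + 1..n + 1}. e + 1 \<le> g i \<and> g i \<le> i)"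
  proof -
    have "chip_bounds n p d k \<longleftrightarrow> (\<forall>i\<in>S. 1 + max 0 (i - p) + k i \<le> g i \<and> g i \<le> n + 1 - max 0 (p - i) - k i)"
      unfolding chip_bounds_def
    proof (intro iffI ballI allI)
      fix i assume "\<forall>i. \<forall>x\<in>d i. 1 + max 0 (i - p) + k i \<le> int x \<and> int x \<le> n + 1 - max 0 (p - i) - k i"
        and i: "i \<in> S"
      then show "1 + max 0 (i - p) + k i \<le> g i \<and> g i \<le> n + 1 - max 0 (p - i) - k i"
        using dS[OF i] g1[OF i] by (auto dest!: spec[of _ i])
    next
      fix i x assume "\<forall>i\<in>S. 1 + max 0 (i - p) + k i \<le> g i \<and> g i \<le> n + 1 - max 0 (p - i) - k i"
        and x: "x \<in> d i"
      moreover from x have i: "i \<in> S" using dN by blast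
      ultimately show "1 + max 0 (i - p) + k i \<le> int x \<and> int x \<le> n + 1 - max 0 (p - i) - k i"
        using dS[OF i] g1[OF i] by auto
    qed
    also have "\<dots> \<longleftrightarrow> (\<forall>i\<in>S. (if i < e then i + 1 else e + 1) \<le> g i \<and> g i \<le> (if i < e then e else i))"
    proof (intro ball_cong refl)
      fix i assume "i \<in> S"
      then have "1 + max 0 (i - p) + k i = (if i < e then i + 1 else e + 1)"
         "n + 1 - max 0 (p - i) - k i = (if i < e then e else i)"
        using kk[of i] e pn unfolding S_def e_def by (smt (verit) Un_iff atLeastAtMost_iff)+
      then show "(1 + max 0 (i - p) + k i \<le> g i \<and> g i \<le> n + 1 - max 0 (p - i) - k i) \<longleftrightarrow>
          ((if i < e then i + 1 else e + 1) \<le> g i \<and> g i \<le> (if i < e then e else i))"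
        by simp
    qed
    finally show ?thesis by (simp add: S_def ball_Un)
  qed
  show ?thesis
  proof
    assume "chip_bounds n p d k"
    then have lo: "\<And>i. i \<in> {0..e - 1} \<Longrightarrow> i + 1 \<le> g i \<and> g i \<le> e"
      and hi: "\<And>i. i \<in> {e + 1..n + 1} \<Longrightarrow> e + 1 \<le> g i \<and> g i \<le> i"
      unfolding bounds by blast+
    \<comment> \<open>An injection into \<open>1..e\<close> lying above the injection
      \<open>i + 1\<close> must coincide with it.\<close>
    have "i + 1 = g i" if "i \<in> {0..e - 1}" for i
    proof (rule inj_on_interval_pointwise_le[where f = "\<lambda>i. i + 1" and A = "{1..e}"])
      show "inj_on g {0..e - 1}" using ginj by (rule inj_on_subset) (simp add: S_def)
      show "g ` {0..e - 1} \<subseteq> {1..e}" using lo by force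
    qed (use lo that in \<open>auto simp: inj_on_def\<close>)
    moreover have "g i = i" if "i \<in> {e + 1..n + 1}" for i
    proof (rule inj_on_interval_pointwise_le[where g = "\<lambda>i. i" and A = "{e + 1..n + 1}"])
      show "inj_on g {e + 1..n + 1}" using ginj by (rule inj_on_subset) (simp add: S_def)
      show "g ` {e + 1..n + 1} \<subseteq> {e + 1..n + 1}" using hi by force
    qed (use hi that in \<open>auto simp: inj_on_def\<close>)
    ultimately have gS: "g i = (if i < e then i + 1 else i)" if "i \<in> S" for i
      using that by (auto simp: S_def)
    show "reads_identity d"
      unfolding reads_identity_def
    proof (intro allI impI)
      fix i j a b assume *: "i < j" "a \<in> d i" "b \<in> d j"
      then have S: "i \<in> S" "j \<in> S" using dN by blast+
      then have "g i < g j" using *(1) by (auto simp: gS) (auto simp: S_def)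
      moreover have "a = nat (g i)" "b = nat (g j)" using * dS S by auto
      ultimately show "a < b" using g1[OF S(1)] by simp
    qed
  next
    assume id: "reads_identity d"
    have mono: "g i < g j" if "i \<in> S" "j \<in> S" "i < j" for i j
    proof -
      have "nat (g i) < nat (g j)"
        using id that dS unfolding reads_identity_def by blast
      then show ?thesis by simp
    qed
    \<comment> \<open>Labels grow by at least one per site; with the outer bounds in
      \<open>ends\<close> and the growth across the hole in \<open>mid\<close>, this squeezes each
      label into its window.\<close>
    have lo: "g i + (j - i) \<le> g j" if "0 \<le> i" "i \<le> j" "j \<le> e - 1" for i j
      by (rule strict_mono_int_gap[of 0 "e - 1"]) (use that mono in \<open>auto simp: S_def\<close>)
    have hi: "g i + (j - i) \<le> g j" if "e + 1 \<le> i" "i \<le> j" "j \<le> n + 1" for i j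
      by (rule strict_mono_int_gap[of "e + 1" "n + 1"]) (use that mono in \<open>auto simp: S_def\<close>)
    have mid: "g (e - 1) < g (e + 1)" using e by (intro mono) (auto simp: S_def)
    have ends: "1 \<le> g 0" "g (n + 1) \<le> n + 1" using e by (auto intro!: g1 simp: S_def)
    show "chip_bounds n p d k"
      unfolding bounds
    proof (intro conjI ballI)
      fix i assume i: "i \<in> {0..e - 1}"
      show "i + 1 \<le> g i" using lo[of 0 i] i ends by simp
      show "g i \<le> e" using lo[of i "e - 1"] hi[of "e + 1" "n + 1"] i mid ends e by simp
    next
      fix i assume i: "i \<in> {e + 1..n + 1}"
      show "g i \<le> i" using hi[of i "n + 1"] i ends by simp
      show "e + 1 \<le> g i" using hi[of "e + 1" i] lo[of 0 "e - 1"] i mid ends e by simp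
    qed
  qed
qed

section \<open>From toppling to position restrictions\<close>

lemma topples_to_identity_iff_chip_bounds:
  assumes "odometer_inv n p c k" "1 \<le> p" "p \<le> n"
  shows "topples_to_identity c \<longleftrightarrow> chip_bounds n p c k"
proof
  assume "topples_to_identity c"
  then obtain d where d: "topple_step\<^sup>*\<^sup>* c d" "stable d" "reads_identity d"
    unfolding topples_to_identity_def by blast
  obtain k' where "odometer_inv n p d k'" "chip_bounds n p c k \<longleftrightarrow> chip_bounds n p d k'"
    using topple_steps_inv[OF d(1) assms] by blast
  then show "chip_bounds n p c k" using stable_chip_bounds_iff d assms by blast
next
  assume b: "chip_bounds n p c k"
  obtain d where d: "topple_step\<^sup>*\<^sup>* c d" "stable d"
    using topple_terminates[OF assms] by blast
  obtain k' where "odometer_inv n p d k'" "chip_bounds n p c k \<longleftrightarrow> chip_bounds n p d k'"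
    using topple_steps_inv[OF d(1) assms] by blast
  then show "topples_to_identity c"
    unfolding topples_to_identity_def using stable_chip_bounds_iff d assms b by blast
qed

text \<open>For \<open>k = 0\<close> the windows effectively bound left positions from above and
  right positions from below. Labels from \<open>r\<close> on are shifted by one:
  \<open>r \<le> n - p + 1\<close> keeps the left bound uniform, while on the right the comparison
  of \<open>i - p\<close> with \<open>r\<close> decides strictness.\<close>

lemma topples_to_identity_init_config:
  assumes \<pi>: "\<pi> permutes {1..n}" and pn: "1 \<le> p" "p \<le> n" and r: "1 \<le> r" "r \<le> n - p + 1"
  shows "topples_to_identity (init_config n \<pi> r p) \<longleftrightarrow>
    (\<forall>i\<in>{1..p}. \<pi> i \<le> n - p + i) \<and>
    (\<forall>i\<in>{p + 1..n}. (if i - p < r then i - p < \<pi> i else i - p \<le> \<pi> i))"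
proof -
  define chip where "chip i = (if \<pi> i < r then \<pi> i else \<pi> i + 1)" for i
  let ?c = "init_config n \<pi> r p"
  have c: "?c i = (if 1 \<le> i \<and> i \<le> int n then {chip (nat i)} else {}) \<union> (if i = int p then {r} else {})" for i
    by (simp add: init_config_def chip_def)
  have rng: "\<pi> i \<in> {1..n}" if "i \<in> {1..n}" for i
    using \<pi> that by (simp add: permutes_in_image del: atLeastAtMost_iff)
  have chip_r: "chip i \<noteq> r" for i by (simp add: chip_def)
  have chip_inj: "i = j" if "chip i = chip j" for i j
  proof -
    have "\<pi> i = \<pi> j" using that by (auto simp: chip_def split: if_splits)
    then show ?thesis using permutes_inj[OF \<pi>] by (simp add: inj_def)
  qed
  have "odometer_inv (int n) (int p) ?c (\<lambda>_. 0)"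
    unfolding odometer_inv_def
  proof (intro conjI allI impI)
    fix i show "int (card (?c i)) = (if 1 \<le> i \<and> i \<le> int n then 1 else 0) + (if i = int p then 1 else 0)
        + 0 + 0 - 2 * 0"
      using chip_r[of "nat i"] pn by (auto simp: c)
  next
    fix i j x assume "x \<in> ?c i" "x \<in> ?c j"
    then show "i = j" using chip_r chip_inj[of "nat i" "nat j"]
      by (auto simp: c chip_r[symmetric] split: if_splits)
  next
    fix i show "?c i \<subseteq> {1..nat (int n + 1)}"
    proof (cases "1 \<le> i \<and> i \<le> int n")
      case True
      then have "nat i \<in> {1..n}" by auto
      from rng[OF this] show ?thesis using r pn by (auto simp: c chip_def nat_add_distrib)
    qed (use pn in \<open>auto simp: c\<close>)
  qed auto
  then have "topples_to_identity ?c \<longleftrightarrow> chip_bounds (int n) (int p) ?c (\<lambda>_. 0)"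
    using pn by (intro topples_to_identity_iff_chip_bounds) auto
  \<comment> \<open>Truncated subtraction replaces \<open>max 0\<close>; the chip \<open>r\<close>
    drops out because its window at \<open>p\<close> is all of \<open>1..n + 1\<close>.\<close>
  also have "\<dots> \<longleftrightarrow> (\<forall>i\<in>{1..n}. 1 + (i - p) \<le> chip i \<and> chip i + (p - i) \<le> n + 1)"
    unfolding chip_bounds_def
  proof (intro iffI ballI allI)
    fix i assume *: "\<forall>i. \<forall>x\<in>?c i. 1 + max 0 (i - int p) + 0 \<le> int x \<and> int x \<le> int n + 1 - max 0 (int p - i) - 0"
      and i: "i \<in> {1..n}"
    have "chip i \<in> ?c (int i)" using i by (simp add: c)
    with * show "1 + (i - p) \<le> chip i \<and> chip i + (p - i) \<le> n + 1"
      by (fastforce simp: max_def split: if_splits)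
  next
    fix i x assume *: "\<forall>i\<in>{1..n}. 1 + (i - p) \<le> chip i \<and> chip i + (p - i) \<le> n + 1"
      and x: "x \<in> ?c i"
    show "1 + max 0 (i - int p) + 0 \<le> int x \<and> int x \<le> int n + 1 - max 0 (int p - i) - 0"
    proof (cases "x = r")
      case True
      then have "i = int p" using x chip_r by (auto simp: c split: if_splits)
      then show ?thesis using True r pn by auto
    next
      case False
      then obtain j where "x = chip j" "i = int j" "j \<in> {1..n}" using x
        by (auto simp: c split: if_splits intro!: that[of "nat i"])
      then show ?thesis using *[rule_format, of j] by (auto simp: max_def)
    qed
  qed
  also have "\<dots> \<longleftrightarrow> (\<forall>i\<in>{1..p}. \<pi> i \<le> n - p + i) \<and>
    (\<forall>i\<in>{p + 1..n}. (if i - p < r then i - p < \<pi> i else i - p \<le> \<pi> i))"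
  proof -
    have "{1..n} = {1..p} \<union> {p + 1..n}" using pn by auto
    moreover have "(1 + (i - p) \<le> chip i \<and> chip i + (p - i) \<le> n + 1) \<longleftrightarrow> \<pi> i \<le> n - p + i" if "i \<in> {1..p}" for i
      using that rng[of i] r pn by (auto simp: chip_def)
    moreover have "(1 + (i - p) \<le> chip i \<and> chip i + (p - i) \<le> n + 1) \<longleftrightarrow>
        (if i - p < r then i - p < \<pi> i else i - p \<le> \<pi> i)" if "i \<in> {p + 1..n}" for i
      using that rng[of i] r pn by (auto simp: chip_def)
    ultimately show ?thesis by (simp add: ball_Un del: atLeastAtMost_iff)
  qed
  finally show ?thesis .
qed

section \<open>Counting restricted permutations\<close>

definition placements :: "'a set \<Rightarrow> 'b set \<Rightarrow> ('a \<Rightarrow> 'b \<Rightarrow> bool) \<Rightarrow> ('a \<Rightarrow> 'b) set" where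
  "placements X Y R = {f \<in> X \<rightarrow>\<^sub>E Y. inj_on f X \<and> (\<forall>x\<in>X. R x (f x))}"

lemma finite_placements: "finite X \<Longrightarrow> finite Y \<Longrightarrow> finite (placements X Y R)"
  unfolding placements_def by (simp add: finite_PiE)

lemma placements_cong:
  assumes "\<And>u v. u \<in> X \<Longrightarrow> v \<in> Y \<Longrightarrow> R u v = R' u v"
  shows "placements X Y R = placements X Y R'"
  unfolding placements_def using assms by (auto simp: PiE_iff)

lemma card_placements_insert:
  assumes X: "finite X" "x \<notin> X" and Y: "finite Y"
  shows "card (placements (insert x X) Y R) =
    (\<Sum>y\<in>{y\<in>Y. R x y}. card (placements X (Y - {y}) R))"
proof -
  let ?P = "\<lambda>y. placements X (Y - {y}) R"
  have eq: "placements (insert x X) Y R = (\<Union>y\<in>{y\<in>Y. R x y}. (\<lambda>f. f(x := y)) ` ?P y)"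
  proof (intro set_eqI iffI)
    fix f assume f: "f \<in> placements (insert x X) Y R"
    have "f(x := undefined) \<in> ?P (f x)"
      using f X(2) unfolding placements_def by (auto simp: PiE_iff extensional_def inj_on_def)
    moreover have "f = (f(x := undefined))(x := f x)" by simp
    moreover have "f x \<in> Y" "R x (f x)" using f unfolding placements_def by auto
    ultimately show "f \<in> (\<Union>y\<in>{y\<in>Y. R x y}. (\<lambda>f. f(x := y)) ` ?P y)" by blast
  next
    fix f assume "f \<in> (\<Union>y\<in>{y\<in>Y. R x y}. (\<lambda>f. f(x := y)) ` ?P y)"
    then show "f \<in> placements (insert x X) Y R"
      using X(2) unfolding placements_def
      by (auto simp: PiE_iff extensional_def inj_on_def split: if_splits)
  qed
  have "card (\<Union>y\<in>{y\<in>Y. R x y}. (\<lambda>f. f(x := y)) ` ?P y) =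
      (\<Sum>y\<in>{y\<in>Y. R x y}. card ((\<lambda>f. f(x := y)) ` ?P y))"
  proof (rule card_UN_disjoint)
    show "\<forall>i\<in>{y\<in>Y. R x y}. \<forall>j\<in>{y\<in>Y. R x y}. i \<noteq> j \<longrightarrow>
        (\<lambda>f. f(x := i)) ` ?P i \<inter> (\<lambda>f. f(x := j)) ` ?P j = {}"
      by (auto dest: fun_cong[where x = x])
  qed (use X Y in \<open>auto intro: finite_placements\<close>)
  also have "\<dots> = (\<Sum>y\<in>{y\<in>Y. R x y}. card (?P y))"
  proof (intro sum.cong refl card_image inj_onI)
    fix y f g assume "f \<in> ?P y" "g \<in> ?P y" and eq: "f(x := y) = g(x := y)"
    then have "f x = undefined" "g x = undefined"
      using X(2) by (auto simp: placements_def PiE_iff extensional_def)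
    with eq show "f = g" by (metis fun_upd_triv fun_upd_upd)
  qed
  finally show ?thesis by (simp add: eq)
qed

text \<open>No position of \<open>E\<close> competes for \<open>L\<close>, so the two blocks are
  filled independently. Truncated subtraction makes the product vanish when \<open>card D\<close>
  exceeds \<open>card L\<close>.\<close>

lemma card_placements_free_block:
  assumes "finite D" "finite E" "finite L" "finite H" "D \<inter> E = {}" "L \<inter> H = {}"
    and "\<And>u v. u \<in> D \<Longrightarrow> v \<in> L \<union> H \<Longrightarrow> Q u v \<longleftrightarrow> v \<in> L"
    and "\<And>u v. u \<in> E \<Longrightarrow> v \<in> L \<union> H \<Longrightarrow> Q u v \<Longrightarrow> v \<in> H"
  shows "card (placements (D \<union> E) (L \<union> H) Q) =
    (\<Prod>i<card D. card L - i) * card (placements E H Q)"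
  using assms
proof (induction D arbitrary: L rule: finite_induct)
  case empty
  then have "placements E (L \<union> H) Q = placements E H Q"
    unfolding placements_def PiE_iff by blast
  then show ?case by simp
next
  case (insert x D)
  have "card (placements (insert x (D \<union> E)) (L \<union> H) Q) =
      (\<Sum>y\<in>{y\<in>L \<union> H. Q x y}. card (placements (D \<union> E) (L \<union> H - {y}) Q))"
    using insert.hyps insert.prems by (intro card_placements_insert) auto
  also have "{y\<in>L \<union> H. Q x y} = L" using insert.prems(6) by auto
  also have "(\<Sum>y\<in>L. card (placements (D \<union> E) (L \<union> H - {y}) Q)) =
      (\<Sum>y\<in>L. (\<Prod>i<card D. card L - Suc i) * card (placements E H Q))"
  proof (intro sum.cong refl)
    fix y assume y: "y \<in> L"
    have "card (placements (D \<union> E) ((L - {y}) \<union> H) Q) =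
        (\<Prod>i<card D. card (L - {y}) - i) * card (placements E H Q)"
    proof (rule insert.IH)
      show "Q u v \<longleftrightarrow> v \<in> L - {y}" if "u \<in> D" "v \<in> L - {y} \<union> H" for u v
        using insert.prems(5) insert.prems(6)[of u v] that y by auto
      show "v \<in> H" if "u \<in> E" "v \<in> L - {y} \<union> H" "Q u v" for u v
        using insert.prems(7)[of u v] that by auto
    qed (use insert.prems in auto)
    moreover have "L \<union> H - {y} = (L - {y}) \<union> H" using y insert.prems by auto
    ultimately show "card (placements (D \<union> E) (L \<union> H - {y}) Q) =
        (\<Prod>i<card D. card L - Suc i) * card (placements E H Q)"
      using y insert.prems by simp
  qed
  finally show ?case
    using insert.hyps by (simp add: prod.lessThan_Suc_shift del: prod.lessThan_Suc)
qed

text \<open>The count left once both staircases are exhausted: a product of two falling factorials,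
  one of which is zero unless the sizes agree.\<close>

lemma card_placements_two_free_blocks:
  assumes "finite D" "finite E" "finite L" "finite H" "D \<inter> E = {}" "L \<inter> H = {}"
    and D: "\<And>u v. u \<in> D \<Longrightarrow> v \<in> L \<union> H \<Longrightarrow> Q u v \<longleftrightarrow> v \<in> L"
    and E: "\<And>u v. u \<in> E \<Longrightarrow> v \<in> L \<union> H \<Longrightarrow> Q u v \<longleftrightarrow> v \<in> H"
    and card: "card D = card H" "card E = card L"
  shows "card (placements (D \<union> E) (L \<union> H) Q) = (if card D = card E then (fact (card D))\<^sup>2 else 0)"
proof -
  have "card (placements (D \<union> E) (L \<union> H) Q) = (\<Prod>i<card D. card L - i) * card (placements (E \<union> {}) (H \<union> {}) Q)"
    using card_placements_free_block[of D E L H Q] assms by simp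
  also have "card (placements (E \<union> {}) (H \<union> {}) Q) = (\<Prod>i<card E. card H - i) * card (placements {} {} Q)"
    using assms by (intro card_placements_free_block) auto
  also have "placements {} {} Q = {\<lambda>_. undefined}"
    by (auto simp: placements_def)
  finally have *: "card (placements (D \<union> E) (L \<union> H) Q) = (\<Prod>i<card D. card E - i) * (\<Prod>i<card E. card D - i)"
    by (simp add: card)
  show ?thesis
  proof (cases "card D = card E")
    case True
    then show ?thesis
      by (simp add: * fact_prod_rev power2_eq_square lessThan_atLeast0)
  next
    case False
    then have "card D < card E \<or> card E < card D" by auto
    then show ?thesis using False unfolding * by auto
  qed
qed

text \<open>The positions \<open>x i\<close> are processed in increasing order of \<open>i\<close>. Each one either takes a still unused
  special value \<open>y l\<close> or is deferred (put into \<open>D\<close>) to receive some value outside the special ones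
  later. The number of special values open to \<open>x i\<close> depends only on the number of deferred positions.\<close>

lemma card_placements_staircase:
  fixes x :: "nat \<Rightarrow> 'a" and y :: "nat \<Rightarrow> 'b"
  assumes x: "inj_on x {..<N}" "x ` {..<N} \<inter> X2 = {}" "finite X2"
    and y: "inj_on y {..<N}" "y ` {..<N} \<inter> Y2 = {}" "finite Y2"
    and R: "\<And>i l. i < N \<Longrightarrow> l < N \<Longrightarrow> R (x i) (y l) \<longleftrightarrow> l < i + w i"
    and w: "\<And>i. w i \<le> 1"
    and final: "\<And>D H. D \<subseteq> x ` {..<N} \<Longrightarrow> H \<subseteq> y ` {..<N} \<Longrightarrow> card D = card H \<Longrightarrow>
       card (placements (D \<union> X2) (H \<union> Y2) (\<lambda>u v. R u v \<and> (u \<in> D \<longrightarrow> v \<in> Y2))) = e (card D)"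
  shows "card (placements (x ` {..<N} \<union> X2) (y ` {..<N} \<union> Y2) R) =
    (\<Sum>a\<le>N. coeff_fwd w N a * e a)"
proof -
  let ?R = "\<lambda>D u v. R u v \<and> (u \<in> D \<longrightarrow> v \<in> Y2)"
  \<comment> \<open>\<open>H\<close> is the pool of special values of processed rows not yet taken.
    Each row adds one value to it and takes one unless deferred, so \<open>D\<close> and
    \<open>H\<close> keep equal size.\<close>
  have "card (placements (D \<union> x ` {N - t..<N} \<union> X2) (H \<union> y ` {N - t..<N} \<union> Y2) (?R D)) =
      coeff_bwd w N e t (card D)"
    if "t \<le> N" "D \<subseteq> x ` {..<N - t}" "H \<subseteq> y ` {..<N - t}" "card D = card H" for t D H
    using that
  proof (induction t arbitrary: D H)
    case 0
    then show ?case using final by simp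
  next
    case (Suc t)
    define i where "i = N - Suc t"
    have i: "i < N" "N - t = Suc i" using Suc.prems by (auto simp: i_def)
    have D: "D \<subseteq> x ` {..<i}" and H: "H \<subseteq> y ` {..<i}" using Suc.prems by (auto simp: i_def)
    have fin: "finite D" "finite H" using D H by (auto intro: finite_subset)
    have xi: "x i \<notin> D" "x i \<notin> x ` {Suc i..<N}" "x i \<notin> X2"
      using D x i by (auto simp: inj_on_def) force+
    have yi: "y i \<notin> H" "y i \<notin> y ` {Suc i..<N}" "y i \<notin> Y2"
      using H y i by (auto simp: inj_on_def) force+
    have Hy: "H \<inter> y ` {Suc i..<N} = {}" "H \<inter> Y2 = {}"
      using H y i by (auto simp: inj_on_def) force+
    have ivl: "{i..<N} = insert i {Suc i..<N}" using i by auto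
    let ?X = "D \<union> x ` {Suc i..<N} \<union> X2"
    let ?Y = "H \<union> y ` {i..<N} \<union> Y2"
    let ?S = "{v \<in> H \<union> y ` {i..<N}. R (x i) v}"
    let ?T = "{v \<in> Y2. R (x i) v}"
    have insX: "D \<union> x ` {i..<N} \<union> X2 = insert (x i) ?X" by (auto simp: ivl)
    have fins: "finite ?X" "finite ?Y" "x i \<notin> ?X" using fin x y xi by auto
    have "card (placements (insert (x i) ?X) ?Y (?R D)) =
        (\<Sum>v\<in>{v\<in>?Y. ?R D (x i) v}. card (placements ?X (?Y - {v}) (?R D)))"
      by (rule card_placements_insert) (use fins in auto)
    also have "{v\<in>?Y. ?R D (x i) v} = ?S \<union> ?T" using xi by auto
    also have "(\<Sum>v\<in>?S \<union> ?T. card (placements ?X (?Y - {v}) (?R D))) =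
        (\<Sum>v\<in>?S. card (placements ?X (?Y - {v}) (?R D))) + (\<Sum>v\<in>?T. card (placements ?X (?Y - {v}) (?R D)))"
    proof (rule sum.union_disjoint)
      have "y ` {i..<N} \<inter> Y2 = {}" using y(2) by force
      then show "?S \<inter> ?T = {}" using Hy(2) by blast
    qed (use fin y in auto)
    also have "(\<Sum>v\<in>?S. card (placements ?X (?Y - {v}) (?R D))) = (w i + card D) * coeff_bwd w N e t (card D)"
    proof -
      have S: "?S = H \<union> (if w i = 1 then {y i} else {})"
      proof -
        have "R (x i) (y l)" if "l < i" for l using R[of i l] i that by simp
        moreover have "R (x i) (y l) \<longleftrightarrow> l = i \<and> w i = 1" if "i \<le> l" "l < N" for l
          using R[of i l] i that w[of i] by auto
        ultimately show ?thesis using H i by auto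
      qed
      have "card (placements ?X (?Y - {v}) (?R D)) = coeff_bwd w N e t (card D)" if v: "v \<in> ?S" for v
      proof -
        have v': "v \<in> insert (y i) H" using v unfolding S by (auto split: if_splits)
        then have "v \<notin> y ` {Suc i..<N}" "v \<notin> Y2" using yi Hy by (metis disjoint_iff insertE)+
        then have Y: "?Y - {v} = (insert (y i) H - {v}) \<union> y ` {Suc i..<N} \<union> Y2"
          unfolding ivl image_insert by (simp add: Un_Diff insert_Diff_if Un_insert_right)
        show ?thesis
          unfolding Y i(2)[symmetric]
        proof (rule Suc.IH)
          show "D \<subseteq> x ` {..<N - t}" "insert (y i) H - {v} \<subseteq> y ` {..<N - t}"
            using D H i by auto
          show "card D = card (insert (y i) H - {v})"
            using v' fin yi Suc.prems by simp
        qed (use Suc.prems in simp)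
      qed
      then have "(\<Sum>v\<in>?S. card (placements ?X (?Y - {v}) (?R D))) = card ?S * coeff_bwd w N e t (card D)"
        by simp
      also have "card ?S = w i + card D"
        unfolding S using fin yi Suc.prems w[of i] by (cases "w i") auto
      finally show ?thesis .
    qed
    also have "(\<Sum>v\<in>?T. card (placements ?X (?Y - {v}) (?R D))) = coeff_bwd w N e t (Suc (card D))"
    proof -
      let ?D = "insert (x i) D"
      \<comment> \<open>The value of a deferred position is not fixed yet: the sum is folded back
        into placements that still contain \<open>x i\<close>, now confined to
        \<open>Y2\<close>.\<close>
      have "(\<Sum>v\<in>?T. card (placements ?X (?Y - {v}) (?R D))) =
         (\<Sum>v\<in>{v\<in>?Y. ?R ?D (x i) v}. card (placements ?X (?Y - {v}) (?R ?D)))"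
      proof (intro sum.cong arg_cong[where f = card] placements_cong)
        fix u v assume "u \<in> ?X"
        then have "u \<noteq> x i" using fins(3) by blast
        then show "?R D u v = ?R ?D u v" by simp
      qed blast
      also have "\<dots> = card (placements (insert (x i) ?X) ?Y (?R ?D))"
        by (rule card_placements_insert[symmetric]) (use fins in auto)
      also have "placements (insert (x i) ?X) ?Y (?R ?D) =
          placements (?D \<union> x ` {N - t..<N} \<union> X2) (insert (y i) H \<union> y ` {N - t..<N} \<union> Y2) (?R ?D)"
        by (simp add: ivl i)
      also have "card (placements (?D \<union> x ` {N - t..<N} \<union> X2) (insert (y i) H \<union> y ` {N - t..<N} \<union> Y2) (?R ?D))
          = coeff_bwd w N e t (card ?D)"
        by (rule Suc.IH) (use D H i fin xi yi Suc.prems in auto)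
      finally show ?thesis using fin xi(1) by simp
    qed
    finally show ?case by (simp only: insX i_def[symmetric] coeff_bwd.simps)
  qed
  from this[of N "{}" "{}"] show ?thesis
    by (simp add: coeff_bwd_eq_sum lessThan_atLeast0)
qed

section \<open>Assembling the count from the two staircases\<close>

lemma card_T_set:
  assumes pn: "1 \<le> p" "p \<le> n" and r: "1 \<le> r" "r \<le> n - p + 1"
  shows "int (card (T_set n r p)) = (\<Sum>a\<le>p. int (Stirling (Suc p) (Suc a)) * ((fact a)\<^sup>2 *
    (fwd_diff ^^ (r - 1)) (\<lambda>m. int (Stirling (Suc m) (Suc a))) (n - p + 1 - r)))"
proof -
  define m where "m = n - p"
  define M where "M = n - p + 1 - r"
  define R where "R u v \<longleftrightarrow> (if u \<le> p then v \<le> m + u else if u - p < r then u - p < v else u - p \<le> v)"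
    for u v :: nat
  define w where "w i = (if i < M then 1 else 0 :: nat)" for i :: nat
  have n: "n = p + m" using pn by (simp add: m_def)
  have T: "T_set n r p = {\<pi>. \<pi> permutes {1..n} \<and> (\<forall>u\<in>{1..n}. R u (\<pi> u))}"
  proof -
    have "{1..n} = {1..p} \<union> {p + 1..n}" using pn by auto
    then have "(\<forall>u\<in>{1..n}. R u (\<pi> u)) \<longleftrightarrow> (\<forall>i\<in>{1..p}. \<pi> i \<le> n - p + i) \<and>
        (\<forall>i\<in>{p + 1..n}. (if i - p < r then i - p < \<pi> i else i - p \<le> \<pi> i))" for \<pi> :: "nat \<Rightarrow> nat"
      by (simp add: R_def m_def ball_Un)
    then show ?thesis
      unfolding T_set_def using topples_to_identity_init_config[OF _ pn r] by auto
  qed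
  \<comment> \<open>Permutations are the identity outside \<open>1..n\<close>, placements are
    \<open>undefined\<close> there.\<close>
  have "bij_betw (\<lambda>\<pi>. restrict \<pi> {1..n}) (T_set n r p) (placements {1..n} {1..n} R)"
  proof (rule bij_betwI[where g = "\<lambda>f i. if i \<in> {1..n} then f i else i"])
    show "(\<lambda>\<pi>. restrict \<pi> {1..n}) \<in> T_set n r p \<rightarrow> placements {1..n} {1..n} R"
    proof
      fix \<pi> assume "\<pi> \<in> T_set n r p"
      then have \<pi>: "\<pi> permutes {1..n}" "\<forall>u\<in>{1..n}. R u (\<pi> u)" by (auto simp: T)
      have "inj_on \<pi> {1..n}" "\<And>u. u \<in> {1..n} \<Longrightarrow> \<pi> u \<in> {1..n}"
        using permutes_inj_on[OF \<pi>(1)] permutes_in_image[OF \<pi>(1)] by blast+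
      then show "restrict \<pi> {1..n} \<in> placements {1..n} {1..n} R"
        using \<pi>(2) unfolding placements_def by (simp add: inj_on_restrict_eq PiE_iff)
    qed
    show "(\<lambda>f i. if i \<in> {1..n} then f i else i) \<in> placements {1..n} {1..n} R \<rightarrow> T_set n r p"
    proof
      fix f assume f: "f \<in> placements {1..n} {1..n} R"
      let ?g = "\<lambda>i. if i \<in> {1..n} then f i else i"
      have "f ` {1..n} = {1..n}"
        using f by (intro endo_inj_surj) (auto simp: placements_def)
      then have "bij_betw f {1..n} {1..n}"
        using f by (simp add: bij_betw_def placements_def)
      then have "bij_betw ?g {1..n} {1..n}"
        by (subst bij_betw_cong[where g = f]) auto
      then have "?g permutes {1..n}" by (rule bij_imp_permutes) (simp only: if_False)
      then show "?g \<in> T_set n r p" using f by (simp add: T placements_def)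
    qed
    show "(\<lambda>i. if i \<in> {1..n} then restrict \<pi> {1..n} i else i) = \<pi>" if "\<pi> \<in> T_set n r p" for \<pi>
      using that by (auto simp: T fun_eq_iff permutes_def)
    show "restrict (\<lambda>i. if i \<in> {1..n} then f i else i) {1..n} = f" if "f \<in> placements {1..n} {1..n} R" for f
      using that by (auto simp: placements_def fun_eq_iff PiE_iff extensional_def)
  qed
  then have "card (T_set n r p) = card (placements {1..n} {1..n} R)"
    by (rule bij_betw_same_card)
  also have "\<dots> = card (placements (Suc ` {..<p} \<union> {p + 1..n}) ((\<lambda>i. m + 1 + i) ` {..<p} \<union> {1..m}) R)"
  proof -
    have "(\<lambda>i. m + 1 + i) ` {..<p} = {m + 1..n}"
    proof -
      have "(\<lambda>i. m + 1 + i) ` {..<p} = (+) (m + 1) ` {0..<p}" by (simp add: lessThan_atLeast0)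
      also have "\<dots> = {m + 1..n}" unfolding image_add_atLeastLessThan n by auto
      finally show ?thesis .
    qed
    moreover have "Suc ` {..<p} = {1..p}" by (simp add: image_Suc_lessThan)
    ultimately show ?thesis
      using pn by (auto intro!: arg_cong[where f = card] arg_cong2[where f = "\<lambda>X Y. placements X Y R"] simp: n)
  qed
  \<comment> \<open>Outer staircase: left positions against the values above \<open>m\<close>.
    Position \<open>Suc i\<close> admits values up to \<open>m + Suc i\<close>, so every row has its
    diagonal cell.\<close>
  also have "\<dots> = (\<Sum>a\<le>p. coeff_fwd (\<lambda>_. 1) p a * (coeff_fwd w m a * (fact a)\<^sup>2))"
  proof (rule card_placements_staircase)
    fix D H assume D: "D \<subseteq> Suc ` {..<p}" and H: "H \<subseteq> (\<lambda>i. m + 1 + i) ` {..<p}" and DH: "card D = card H"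
    have finDH: "finite D" "finite H" using D H by (auto intro: finite_subset)
    have D': "\<And>u. u \<in> D \<Longrightarrow> 1 \<le> u \<and> u \<le> p" and H': "\<And>v. v \<in> H \<Longrightarrow> m < v" using D H by auto
    let ?Q = "\<lambda>u v. R u v \<and> (u \<in> D \<longrightarrow> v \<in> {1..m})"
    have xs: "(\<lambda>i. n - i) ` {..<m} = {p + 1..n}"
    proof -
      have "u \<in> (\<lambda>i. n - i) ` {..<m}" if "u \<in> {p + 1..n}" for u
        by (rule image_eqI[where x = "n - u"]) (use that n in auto)
      then show ?thesis using n by auto
    qed
    have ys: "(\<lambda>i. m - i) ` {..<m} = {1..m}"
    proof -
      have "u \<in> (\<lambda>i. m - i) ` {..<m}" if "u \<in> {1..m}" for u
        by (rule image_eqI[where x = "m - u"]) (use that in auto)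
      then show ?thesis by auto
    qed
    \<comment> \<open>Inner staircase: right positions against small values, both enumerated
      downwards so that lower bounds become a staircase. The leftovers \<open>D\<close> and
      \<open>H\<close> of the outer one serve as \<open>X2\<close> and \<open>Y2\<close>.\<close>
    have "card (placements ((\<lambda>i. n - i) ` {..<m} \<union> D) ((\<lambda>i. m - i) ` {..<m} \<union> H) ?Q) =
       (\<Sum>b\<le>m. coeff_fwd w m b * (if b = card D then (fact b)\<^sup>2 else 0))"
    proof (rule card_placements_staircase)
      fix E L assume E: "E \<subseteq> (\<lambda>i. n - i) ` {..<m}" and L: "L \<subseteq> (\<lambda>i. m - i) ` {..<m}" and EL: "card E = card L"
      have finEL: "finite E" "finite L" using E L by (auto intro: finite_subset)
      have E': "\<And>u. u \<in> E \<Longrightarrow> p < u \<and> u \<le> n" and L': "\<And>v. v \<in> L \<Longrightarrow> 1 \<le> v \<and> v \<le> m"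
        using E L unfolding xs ys by force+
      \<comment> \<open>Deferred right positions \<open>E\<close> may take exactly the leftover
        large values \<open>H\<close>, deferred left positions \<open>D\<close> exactly the leftover
        small values \<open>L\<close>.\<close>
      have "card (placements (E \<union> D) (H \<union> L) (\<lambda>u v. ?Q u v \<and> (u \<in> E \<longrightarrow> v \<in> H))) =
          (if card E = card D then (fact (card E))\<^sup>2 else 0)"
      proof (rule card_placements_two_free_blocks)
        show "E \<inter> D = {}" using E' D' by force
        show "H \<inter> L = {}" using H' L' by force
        show "(R u v \<and> (u \<in> D \<longrightarrow> v \<in> {1..m})) \<and> (u \<in> E \<longrightarrow> v \<in> H) \<longleftrightarrow> v \<in> H"
          if u: "u \<in> E" and v: "v \<in> H \<union> L" for u v
        proof -
          have "u \<notin> D" using u E' D' by force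
          moreover have "R u v" if "v \<in> H" using that H'[of v] E'[OF u] n by (auto simp: R_def)
          ultimately show ?thesis using u by auto
        qed
        show "(R u v \<and> (u \<in> D \<longrightarrow> v \<in> {1..m})) \<and> (u \<in> E \<longrightarrow> v \<in> H) \<longleftrightarrow> v \<in> L"
          if u: "u \<in> D" and v: "v \<in> H \<union> L" for u v
        proof -
          have "u \<notin> E" using u E' D' by force
          moreover have "R u v" if "v \<in> L" using that L'[of v] D'[OF u] by (auto simp: R_def)
          moreover have "v \<in> {1..m} \<longleftrightarrow> v \<in> L" using v H' L' by force
          ultimately show ?thesis using u by auto
        qed
      qed (use finDH finEL DH EL in auto)
      then show "card (placements (E \<union> D) (L \<union> H) (\<lambda>u v. ?Q u v \<and> (u \<in> E \<longrightarrow> v \<in> H))) =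
          (if card E = card D then (fact (card E))\<^sup>2 else 0)"
        by (simp add: Un_commute)
    next
      fix i l assume il: "i < m" "l < m"
      have "n - i \<notin> D" using D' il n by force
      moreover have "n - i - p = m - i" "\<not> n - i \<le> p" using il n by auto
      \<comment> \<open>The first \<open>M\<close> rows have the weak inequality and hence the
        diagonal cell; the last \<open>r - 1\<close> rows lack it.\<close>
      moreover have "m - i < r \<longleftrightarrow> \<not> i < M" using il r n by (auto simp: M_def)
      ultimately show "(R (n - i) (m - l) \<and> (n - i \<in> D \<longrightarrow> m - l \<in> {1..m})) \<longleftrightarrow> l < i + w i"
        using il by (auto simp: R_def w_def)
    next
      show "inj_on (\<lambda>i. n - i) {..<m}" "inj_on (\<lambda>i. m - i) {..<m}"
        using n by (auto simp: inj_on_def)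
      show "(\<lambda>i. n - i) ` {..<m} \<inter> D = {}" unfolding xs using D' by force
      show "(\<lambda>i. m - i) ` {..<m} \<inter> H = {}" unfolding ys using H' by force
    qed (use finDH in \<open>auto simp: w_def\<close>)
    \<comment> \<open>If \<open>card D\<close> exceeds \<open>m\<close>, no index \<open>b\<close>
      matches and \<open>coeff_fwd\<close> is zero as well.\<close>
    also have "\<dots> = coeff_fwd w m (card D) * (fact (card D))\<^sup>2"
      by (simp add: if_distrib sum.delta coeff_fwd_eq_0 cong: if_cong)
    finally show "card (placements (D \<union> {p + 1..n}) (H \<union> {1..m}) ?Q) = coeff_fwd w m (card D) * (fact (card D))\<^sup>2"
      by (simp add: xs ys Un_commute)
  qed (auto simp: R_def inj_on_def)
  finally have "int (card (T_set n r p)) =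
      (\<Sum>a\<le>p. int (coeff_fwd (\<lambda>_. 1) p a) * (int (coeff_fwd w m a) * (fact a)\<^sup>2))"
    by simp
  moreover have "int (coeff_fwd w m a) = (fwd_diff ^^ (r - 1)) (\<lambda>m. int (Stirling (Suc m) (Suc a))) M" for a
  proof -
    have "m = M + (r - 1)" using r by (simp add: M_def m_def)
    then show ?thesis
      using coeff_fwd_eq_fwd_diff[of M "r - 1" a] by (simp add: w_def[abs_def])
  qed
  ultimately show ?thesis
    by (simp only: coeff_fwd_one M_def mult.commute)
qed

text \<open>The added terms with \<open>a > m\<close> contain a vanishing Stirling number. A range
  independent of \<open>m\<close> lets differences in \<open>m\<close> act on each summand.\<close>

lemma polyB_eq_sum:
  "polyB m p = (\<Sum>a\<le>p. (int (Stirling (Suc p) (Suc a)) * (fact a)\<^sup>2) * int (Stirling (Suc m) (Suc a)))"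
proof -
  have "polyB m p = (\<Sum>a = 0..min m p. (int (Stirling (Suc p) (Suc a)) * (fact a)\<^sup>2) * int (Stirling (Suc m) (Suc a)))"
    unfolding polyB_def by (intro sum.cong) (auto simp: algebra_simps simp del: Stirling.simps)
  also have "\<dots> = (\<Sum>a\<le>p. (int (Stirling (Suc p) (Suc a)) * (fact a)\<^sup>2) * int (Stirling (Suc m) (Suc a)))"
    by (intro sum.mono_neutral_left) (auto simp del: Stirling.simps)
  finally show ?thesis .
qed

theorem theorem2p6:
  fixes n p r :: nat
  assumes "1 \<le> p" and "p \<le> n" and "1 \<le> r" and "r \<le> n - p + 1"
  shows "int (card (T_set n r p)) = (fwd_diff ^^ (r - 1)) (\<lambda>m. polyB m p) (n - p + 1 - r)
    \<and> int (card (T_set n r p)) =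
      (\<Sum>j = 0..r - 1. (-1) ^ (r - 1 - j) * int ((r - 1) choose j) * polyB (n - p + 1 - r + j) p)"
proof -
  have "(fwd_diff ^^ (r - 1)) (\<lambda>m. polyB m p) (n - p + 1 - r) = int (card (T_set n r p))"
    unfolding polyB_eq_sum fwd_diff_funpow_sum card_T_set[OF assms] by (simp only: mult.assoc)
  then show ?thesis
    by (simp only: fwd_diff_funpow_eq_sum)
qed

end
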